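(* Let $X_1, X_2, \ldots, X_{d+1}$ be $d+1$ finite sets of points in $(\mathbb{R}\cup\{-\infty\})^d$ and let $\boldsymbol{p}\in(\mathbb{R}\cup\{-\infty\})^d$ be a point such that the max-plus convex hull of each $X_i$ contains $\boldsymbol{p}$. Then there are $d+1$ points $\boldsymbol{x}_1,\boldsymbol{x}_2,\ldots,\boldsymbol{x}_{d+1}$ such that $\boldsymbol{x}_i\in X_i$ for each $i$ and such that $\mathrm{mpconv}\{\boldsymbol{x}_1,\boldsymbol{x}_2,\ldots,\boldsymbol{x}_{d+1}\}$ contains the point $\boldsymbol{p}$.
   Context: Write $\mathbb{R}_{\max}=\mathbb{R}\cup\{-\infty\}$, with $-\infty+a=-\infty$ for all $a\in\mathbb{R}_{\max}$ and $-\infty\le a$ for all $a$. For $\lambda\in\mathbb{R}_{\max}$ and $\boldsymbol{x}=(x_1,\ldots,x_d)\in\mathbb{R}_{\max}^d$, $\lambda+\boldsymbol{x}$ denotes $(\lambda+x_1,\ldots,\lambda+x_d)$; the maximum of finitely many vectors is taken componentwise. The max-plus convex hull $\mathrm{mpconv}\{\boldsymbol{x}_1,\ldots,\boldsymbol{x}_n\}$ of points $\boldsymbol{x}_1,\ldots,\boldsymbol{x}_n\in\mathbb{R}_{\max}^d$ is the set of points $\boldsymbol{x}\in\mathbb{R}_{\max}^d$ for which there exist $\lambda_1,\ldots,\lambda_n\in\mathbb{R}_{\max}$ with $\max_{i}\lambda_i=0$ and $\boldsymbol{x}=\max_{i=1,\ldots,n}(\lambda_i+\boldsymbol{x}_i)$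 (in particular the hull of the empty set is empty). *)

theory Defs
  imports "HOL-Analysis.Analysis"
begin

text \<open>
  The max-plus semifield is embedded in the extended reals by leaving out \<open>\<infinity>\<close>.
  On this subset the addition and the order of \<^typ>\<open>ereal\<close> are those of the max-plus
  setting; in particular \<open>-\<infinity> + a = -\<infinity>\<close> (which fails in \<^typ>\<open>ereal\<close> only for \<open>a = \<infinity>\<close>).
\<close>

definition Rmax :: "ereal set" where
  "Rmax = {a. a \<noteq> \<infinity>}"

definition Rmax_space :: "(ereal ^ 'd) set" where
  "Rmax_space = {x. \<forall>j. x $ j \<in> Rmax}"

text \<open>
  The hull is meant for finite \<open>X\<close>. The condition \<open>X \<noteq> {}\<close> is needed because \<^term>\<open>Max {}\<close> is
  unspecified; it makes the hull of the empty set empty.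
  Coefficients are attached to the elements of the set; \<open>mpconv_image\<close> below shows that
  attaching them to the indices of a family, possibly with repetitions, gives the same hull.
\<close>

definition mpconv :: "(ereal ^ 'd) set \<Rightarrow> (ereal ^ 'd) set" where
  "mpconv X = {x \<in> Rmax_space. X \<noteq> {} \<and>
     (\<exists>l. (\<forall>y\<in>X. l y \<in> Rmax) \<and> Max (l ` X) = 0 \<and>
          x = (\<chi> j. Max ((\<lambda>y. l y + y $ j) ` X)))}"

lemma mpconv_image:
  fixes f :: "'i \<Rightarrow> ereal ^ 'd"
  assumes fin: "finite I" and ne: "I \<noteq> {}"
  shows "mpconv (f ` I) = {x \<in> Rmax_space.
     \<exists>l. (\<forall>i\<in>I. l i \<in> Rmax) \<and> Max (l ` I) = 0 \<and>
          x = (\<chi> j. Max ((\<lambda>i. l i + f i $ j) ` I))}" (is "?L = ?R")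
proof
  show "?L \<subseteq> ?R"
  proof
    fix x assume "x \<in> ?L"
    then obtain l where "x \<in> Rmax_space" "\<forall>y\<in>f ` I. l y \<in> Rmax" "Max (l ` f ` I) = 0"
      "x = (\<chi> j. Max ((\<lambda>y. l y + y $ j) ` f ` I))"
      by (auto simp: mpconv_def)
    then show "x \<in> ?R"
      by (auto simp: image_image intro!: exI[of _ "\<lambda>i. l (f i)"])
  qed
next
  show "?R \<subseteq> ?L"
  proof
    fix x assume "x \<in> ?R"
    then obtain l where x: "x \<in> Rmax_space" and l: "\<forall>i\<in>I. l i \<in> Rmax" "Max (l ` I) = 0"
      and xeq: "x = (\<chi> j. Max ((\<lambda>i. l i + f i $ j) ` I))"
      by auto
    define F where "F y = {i \<in> I. f i = y}" for y
    define m where "m y = Max (l ` F y)" for y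
    have finF: "finite (F y)" for y using fin by (simp add: F_def)
    have m_in: "\<exists>i\<in>I. f i = y \<and> m y = l i" if "y \<in> f ` I" for y
    proof -
      have "F y \<noteq> {}" using that by (auto simp: F_def)
      then have "m y \<in> l ` F y" unfolding m_def using finF by (intro Max_in) auto
      then show ?thesis by (auto simp: F_def)
    qed
    have m_ge: "l i \<le> m (f i)" if "i \<in> I" for i
      unfolding m_def using that finF by (intro Max_ge) (auto simp: F_def)
    have gen: "Max ((\<lambda>y. m y + g y) ` f ` I) = Max ((\<lambda>i. l i + g (f i)) ` I)" for g
    proof (rule antisym)
      show "Max ((\<lambda>y. m y + g y) ` f ` I) \<le> Max ((\<lambda>i. l i + g (f i)) ` I)"
      proof (rule Max.boundedI)
        fix a assume "a \<in> (\<lambda>y. m y + g y) ` f ` I"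
        then obtain y where y: "y \<in> f ` I" "a = m y + g y" by auto
        then obtain i where "i \<in> I" "f i = y" "m y = l i" using m_in by blast
        then have "a \<in> (\<lambda>i. l i + g (f i)) ` I" using y by auto
        then show "a \<le> Max ((\<lambda>i. l i + g (f i)) ` I)" using fin by simp
      qed (use fin ne in auto)
      show "Max ((\<lambda>i. l i + g (f i)) ` I) \<le> Max ((\<lambda>y. m y + g y) ` f ` I)"
      proof (rule Max.boundedI)
        fix a assume "a \<in> (\<lambda>i. l i + g (f i)) ` I"
        then obtain i where i: "i \<in> I" "a = l i + g (f i)" by auto
        then have "a \<le> m (f i) + g (f i)" using m_ge by (simp add: add_right_mono)
        also have "\<dots> \<le> Max ((\<lambda>y. m y + g y) ` f ` I)" using i fin by (intro Max_ge) auto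
        finally show "a \<le> Max ((\<lambda>y. m y + g y) ` f ` I)" .
      qed (use fin ne in auto)
    qed
    have "Max (m ` f ` I) = 0" using gen[of "\<lambda>_. 0"] l(2) by simp
    moreover have "\<forall>y\<in>f ` I. m y \<in> Rmax" using m_in l(1) by metis
    moreover have "x = (\<chi> j. Max ((\<lambda>y. m y + y $ j) ` f ` I))"
      using xeq gen[of "\<lambda>y. y $ _"] by simp
    ultimately show "x \<in> ?L" using x ne unfolding mpconv_def by blast
  qed
qed

end

theory Submission
  imports Defs
begin

text \<open>
  Regard the normalization \<open>max \<lambda>\<^sub>i = 0\<close> as one more coordinate, so that there are \<open>d + 1\<close>
  coordinates. In a representation of \<open>p\<close> as a point of the hull of \<open>X\<^sub>i\<close> every scaled generator
  lies below \<open>p\<close>, and every coordinate of \<open>p\<close> is attained by one of them. Match the sets \<open>X\<^sub>i\<close>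
  bijectively with the coordinates and let \<open>x\<^sub>i\<close> be a generator from \<open>X\<^sub>i\<close>
  attaining the coordinate matched with \<open>i\<close>; the old coefficients of the \<open>x\<^sub>i\<close> then represent \<open>p\<close>.
\<close>

text \<open>\<open>None\<close> is the coordinate added for the normalization: there every generator
  and \<open>p\<close> have entry 0, so attaining it means \<open>l = 0\<close>.\<close>

definition attains :: "ereal ^ 'd \<Rightarrow> ereal \<Rightarrow> ereal ^ 'd \<Rightarrow> 'd option \<Rightarrow> bool" where
  "attains p l y c = (case c of None \<Rightarrow> l = 0 | Some j \<Rightarrow> l + y $ j = p $ j)"

text \<open>A maximum over a finite nonempty set is attained, so \<open>c\<close> may be prescribed
  in advance; the inequalities hold for every generator.\<close>

lemma mpconv_attains:
  assumes fin: "finite X" and p: "p \<in> mpconv X"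
  obtains y l where "y \<in> X" "l \<in> Rmax" "l \<le> 0" "\<And>j. l + y $ j \<le> p $ j" "attains p l y c"
proof -
  from p obtain l where ne: "X \<noteq> {}" and l: "\<forall>y\<in>X. l y \<in> Rmax" and l0: "Max (l ` X) = 0"
    and peq: "p = (\<chi> j. Max ((\<lambda>y. l y + y $ j) ` X))"
    by (auto simp: mpconv_def)
  have pj: "p $ j = Max ((\<lambda>y. l y + y $ j) ` X)" for j
    by (subst peq) simp
  have "\<exists>y\<in>X. attains p (l y) y c"
  proof (cases c)
    case None
    have "0 \<in> l ` X"
      using Max_in[of "l ` X"] fin ne l0 by simp
    then show ?thesis
      using None by (auto simp: attains_def)
  next
    case (Some j)
    have "p $ j \<in> (\<lambda>y. l y + y $ j) ` X"
      unfolding pj using fin ne by (intro Max_in) auto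
    then show ?thesis
      using Some by (auto simp: attains_def)
  qed
  then obtain y where y: "y \<in> X" "attains p (l y) y c" ..
  moreover have "l y \<le> 0"
    unfolding l0[symmetric] using fin y(1) by simp
  moreover have "l y + y $ j \<le> p $ j" for j
    unfolding pj using fin y(1) by simp
  ultimately show thesis
    using l that by blast
qed

text \<open>Converse direction: an upper bound that is attained is the maximum, in each coordinate
  and in the normalization.\<close>

lemma mpconv_imageI:
  assumes fin: "finite I" and p: "p \<in> Rmax_space"
    and l: "\<And>i. i \<in> I \<Longrightarrow> l i \<in> Rmax" "\<And>i. i \<in> I \<Longrightarrow> l i \<le> 0"
    and le: "\<And>i j. i \<in> I \<Longrightarrow> l i + x i $ j \<le> p $ j"
    and att: "\<And>c. \<exists>i\<in>I. attains p (l i) (x i) c"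
  shows "p \<in> mpconv (x ` I)"
proof -
  have ne: "I \<noteq> {}"
    using att by blast
  have "0 \<in> l ` I"
    using att[of None] by (force simp: attains_def)
  then have "Max (l ` I) = 0"
    using fin l(2) by (intro Max_eqI) auto
  moreover have "Max ((\<lambda>i. l i + x i $ j) ` I) = p $ j" for j
  proof (rule Max_eqI)
    show "p $ j \<in> (\<lambda>i. l i + x i $ j) ` I"
      using att[of "Some j"] by (force simp: attains_def)
  qed (use fin le in auto)
  ultimately show ?thesis
    \<comment> \<open>The points \<open>x i\<close> may coincide while their coefficients differ, so
      the coefficients are indexed by \<open>I\<close>.\<close>
    unfolding mpconv_image[OF fin ne] using p l(1)
    by (auto simp: vec_eq_iff intro!: exI[of _ l])
qed

theorem theorem7:
  fixes X :: "nat \<Rightarrow> (ereal ^ 'd) set" and p :: "ereal ^ 'd"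
  assumes "\<And>i. i \<in> {1..CARD('d) + 1} \<Longrightarrow> finite (X i)"
    and "\<And>i. i \<in> {1..CARD('d) + 1} \<Longrightarrow> X i \<subseteq> Rmax_space"
    and "p \<in> Rmax_space"
    and "\<And>i. i \<in> {1..CARD('d) + 1} \<Longrightarrow> p \<in> mpconv (X i)"
  shows "\<exists>x :: nat \<Rightarrow> ereal ^ 'd. (\<forall>i \<in> {1..CARD('d) + 1}. x i \<in> X i) \<and>
           p \<in> mpconv (x ` {1..CARD('d) + 1})"
proof -
  let ?I = "{1..CARD('d) + 1}"
  have "card ?I = card (UNIV :: 'd option set)"
    by (simp add: card_UNIV_option)
  then obtain b :: "nat \<Rightarrow> 'd option" where b: "bij_betw b ?I UNIV"
    using finite_same_card_bij[of ?I "UNIV :: 'd option set"] by auto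
  have "\<forall>i\<in>?I. \<exists>yl. fst yl \<in> X i \<and> snd yl \<in> Rmax \<and> snd yl \<le> 0 \<and>
      (\<forall>j. snd yl + fst yl $ j \<le> p $ j) \<and> attains p (snd yl) (fst yl) (b i)"
  proof
    fix i assume i: "i \<in> ?I"
    obtain y l where "y \<in> X i" "l \<in> Rmax" "l \<le> 0" "\<And>j. l + y $ j \<le> p $ j" "attains p l y (b i)"
      by (rule mpconv_attains[OF assms(1)[OF i] assms(4)[OF i], where c = "b i"]) blast
    then show "\<exists>yl. fst yl \<in> X i \<and> snd yl \<in> Rmax \<and> snd yl \<le> 0 \<and>
        (\<forall>j. snd yl + fst yl $ j \<le> p $ j) \<and> attains p (snd yl) (fst yl) (b i)"
      by (intro exI[of _ "(y, l)"]) simp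
  qed
  from bchoice[OF this] obtain f where f: "\<forall>i\<in>?I. fst (f i) \<in> X i \<and> snd (f i) \<in> Rmax \<and>
      snd (f i) \<le> 0 \<and> (\<forall>j. snd (f i) + fst (f i) $ j \<le> p $ j) \<and>
      attains p (snd (f i)) (fst (f i)) (b i)" ..
  define x l where "x i = fst (f i)" and "l i = snd (f i)" for i
  have xl: "x i \<in> X i" "l i \<in> Rmax" "l i \<le> 0" "l i + x i $ j \<le> p $ j"
    "attains p (l i) (x i) (b i)" if "i \<in> ?I" for i j
    using f that unfolding x_def l_def by blast+
  \<comment> \<open>By surjectivity of \<open>b\<close>, each coordinate is the one for which some
    \<open>x i\<close> was chosen.\<close>
  have "\<exists>i\<in>?I. attains p (l i) (x i) c" for c
  proof -
    have "c \<in> b ` ?I"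
      using b by (simp add: bij_betw_def)
    then show ?thesis
      using xl(5) by blast
  qed
  then have "p \<in> mpconv (x ` ?I)"
    by (intro mpconv_imageI[where l = l] finite_atLeastAtMost assms(3) xl(2-4))
  then show ?thesis
    using xl(1) by blast
qed

end
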